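(* There exists a constant $c>1$ such that, for all nonnegative integers $\alpha$ and $\beta$ with $\beta\le 2^{2^{\alpha}}$, \[ \frac{\tau(\alpha)}{c}\le m(\mathcal{N}_{\alpha,\beta})\le c\,\tau(\alpha). \]
   Context: $\mathbb{N}=\{1,2,\dots\}$; $\log$ is the binary logarithm. $K(\cdot)$ and $K(\cdot\mid\cdot)$ denote (conditional) prefix Kolmogorov complexity with respect to a fixed optimal prefix-free machine, applied to finite objects (natural numbers, finite subsets of $\mathbb{N}$) via a standard computable encoding (a finite set is given by an explicit list of its elements). $m$ is a fixed universal semimeasure on $\mathbb{N}$, i.e. a lower semicomputable function $m:\mathbb{N}\to[0,\infty)$ with $\sum_{n}m(n)\le 1$ that dominates, up to a positive multiplicative constant, every lower semicomputable semimeasure on $\mathbb{N}$. For $A\subseteq\mathbb{N}$, $m(A):=\sum_{a\in A}m(a)$. For an integer $t\ge 0$, $\tau(t):=m(\{t+1,t+2,\dots\})$. For nonnegative integers $\alpha,\beta$, an object $\omega\in\mathbb{N}$ is $(\alpha,\beta)$-stochastic if there exists a finite set $\Omega\subseteq\mathbb{N}$ such that $\omega\in\Omega$, $K(\Omega)\le\alpha$, and $K(\omega\mid\Omega)\ge\log|\Omega|-\beta$; otherwise $\omega$ is $(\alpha,\beta)$-nonstochastic. $\mathcal{N}_{\alpha,\beta}\subseteq\mathbb{N}$ is the set of all $(\alpha,\beta)$-nonstochastic objects. Constants may depend on the fixed choices of $m$ and of the optimal machine, but not on $\alpha,\beta$. *)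

theory Defs
  imports
    "HOL-Analysis.Infinite_Sum"
    "HOL-Library.Nat_Bijection"
    "HOL-Library.Sublist"
    "HOL-Library.Extended_Nat"
    "HOL-Library.Extended_Real"
begin

section \<open>Partial recursive functions\<close>

text \<open>
  Kleene's partial recursive functions, as functions of one argument. Tuples are passed as
  \<^const>\<open>prod_encode\<close> (the Cantor pairing), so the two projections are initial functions
  and pairing is a closure rule. \<^const>\<open>None\<close> means divergence.
\<close>

definition prim_rec ::
    "(nat \<Rightarrow> nat option) \<Rightarrow> (nat \<Rightarrow> nat option) \<Rightarrow> nat \<Rightarrow> nat option" where
  "prim_rec f g z =
     (let (a, n) = prod_decode z in
        rec_nat (f a) (\<lambda>k r. Option.bind r (\<lambda>v. g (prod_encode (a, prod_encode (k, v))))) n)"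

definition minimize :: "(nat \<Rightarrow> nat option) \<Rightarrow> nat \<Rightarrow> nat option" where
  "minimize f a =
     (if \<exists>n. f (prod_encode (a, n)) = Some 0 \<and>
             (\<forall>k<n. \<exists>v. f (prod_encode (a, k)) = Some (Suc v))
      then Some (LEAST n. f (prod_encode (a, n)) = Some 0)
      else None)"

inductive partial_recursive :: "(nat \<Rightarrow> nat option) \<Rightarrow> bool" where
  zero: "partial_recursive (\<lambda>x. Some 0)"
| succ: "partial_recursive (\<lambda>x. Some (Suc x))"
| left: "partial_recursive (\<lambda>z. Some (fst (prod_decode z)))"
| right: "partial_recursive (\<lambda>z. Some (snd (prod_decode z)))"
| pair: "partial_recursive f \<Longrightarrow> partial_recursive g \<Longrightarrow>
    partial_recursive
      (\<lambda>x. Option.bind (f x) (\<lambda>u. Option.bind (g x) (\<lambda>v. Some (prod_encode (u, v)))))"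
| comp: "partial_recursive f \<Longrightarrow> partial_recursive g \<Longrightarrow>
    partial_recursive (\<lambda>x. Option.bind (g x) f)"
| prim_rec: "partial_recursive f \<Longrightarrow> partial_recursive g \<Longrightarrow>
    partial_recursive (prim_rec f g)"
| minimize: "partial_recursive f \<Longrightarrow> partial_recursive (minimize f)"

definition computable2 :: "(nat \<Rightarrow> nat \<Rightarrow> nat) \<Rightarrow> bool" where
  "computable2 h \<longleftrightarrow> partial_recursive (\<lambda>z. Some (case prod_decode z of (n, k) \<Rightarrow> h n k))"


section \<open>Semimeasures on the positive integers\<close>

text \<open>
  The underlying set is \<open>{1..}\<close>; values at \<open>0\<close> play no role.
  Lower semicomputable means: uniformly in \<open>n\<close>, the limit of a computable nondecreasing
  sequence of (nonnegative) rationals.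
\<close>

definition lower_semicomputable :: "(nat \<Rightarrow> real) \<Rightarrow> bool" where
  "lower_semicomputable f \<longleftrightarrow>
     (\<exists>p q. computable2 p \<and> computable2 q \<and>
        (\<forall>n\<ge>1. (\<forall>k. q n k > 0) \<and>
                incseq (\<lambda>k. real (p n k) / real (q n k)) \<and>
                (\<lambda>k. real (p n k) / real (q n k)) \<longlonglongrightarrow> f n))"

definition semimeasure :: "(nat \<Rightarrow> real) \<Rightarrow> bool" where
  "semimeasure f \<longleftrightarrow>
     (\<forall>n\<ge>1. 0 \<le> f n) \<and> f summable_on {1..} \<and> (\<Sum>\<^sub>\<infinity>n\<in>{1..}. f n) \<le> 1"

definition universal_semimeasure :: "(nat \<Rightarrow> real) \<Rightarrow> bool" where
  "universal_semimeasure m \<longleftrightarrow>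
     semimeasure m \<and> lower_semicomputable m \<and>
     (\<forall>f. semimeasure f \<and> lower_semicomputable f \<longrightarrow> (\<exists>C>0. \<forall>n\<ge>1. f n \<le> C * m n))"

definition mass :: "(nat \<Rightarrow> real) \<Rightarrow> nat set \<Rightarrow> real" where
  "mass m A = (\<Sum>\<^sub>\<infinity>a\<in>A. m a)"

definition tau :: "(nat \<Rightarrow> real) \<Rightarrow> nat \<Rightarrow> real" where
  "tau m t = mass m {t + 1..}"


section \<open>Prefix Kolmogorov complexity\<close>

text \<open>
  A machine maps a program (a bit string) and a condition to an output, if it halts.
  Conditions and outputs are natural numbers coding finite objects.
\<close>

type_synonym machine = "bool list \<Rightarrow> nat \<Rightarrow> nat option"

definition bits_code :: "bool list \<Rightarrow> nat" where
  "bits_code p = list_encode (map of_bool p)"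

definition computable_machine :: "machine \<Rightarrow> bool" where
  "computable_machine M \<longleftrightarrow>
     (\<exists>f. partial_recursive f \<and> (\<forall>p y. M p y = f (prod_encode (bits_code p, y))))"

definition prefix_free_machine :: "machine \<Rightarrow> bool" where
  "prefix_free_machine M \<longleftrightarrow>
     computable_machine M \<and>
     (\<forall>y p q. M p y \<noteq> None \<and> M q y \<noteq> None \<and> prefix p q \<longrightarrow> p = q)"

text \<open>The infimum is \<open>\<infinity>\<close> if no program produces \<open>x\<close>.\<close>

definition cond_complexity :: "machine \<Rightarrow> nat \<Rightarrow> nat \<Rightarrow> enat" where
  "cond_complexity M x y = (INF p\<in>{p. M p y = Some x}. enat (length p))"

definition optimal_prefix_free_machine :: "machine \<Rightarrow> bool" where
  "optimal_prefix_free_machine U \<longleftrightarrow>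
     prefix_free_machine U \<and>
     (\<forall>M. prefix_free_machine M \<longrightarrow>
        (\<exists>C::nat. \<forall>x y. cond_complexity U x y \<le> cond_complexity M x y + enat C))"

text \<open>Unconditional complexity uses the trivial condition \<open>0 = list_encode []\<close>.\<close>

definition complexity :: "machine \<Rightarrow> nat \<Rightarrow> enat" where
  "complexity M x = cond_complexity M x 0"


section \<open>Stochastic objects\<close>

text \<open>A number is its own code; a finite set is coded by the list of its elements.\<close>

definition set_code :: "nat set \<Rightarrow> nat" where
  "set_code A = list_encode (sorted_list_of_set A)"

definition stochastic :: "machine \<Rightarrow> nat \<Rightarrow> nat \<Rightarrow> nat \<Rightarrow> bool" where
  "stochastic U \<alpha> \<beta> \<omega> \<longleftrightarrow>
     (\<exists>\<Omega>. finite \<Omega> \<and> \<Omega> \<subseteq> {1..} \<and> \<omega> \<in> \<Omega> \<and>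
          complexity U (set_code \<Omega>) \<le> enat \<alpha> \<and>
          ereal_of_enat (cond_complexity U \<omega> (set_code \<Omega>)) \<ge>
            ereal (log 2 (real (card \<Omega>)) - real \<beta>))"

definition nonstochastic_set :: "machine \<Rightarrow> nat \<Rightarrow> nat \<Rightarrow> nat set" where
  "nonstochastic_set U \<alpha> \<beta> = {\<omega>. \<omega> \<ge> 1 \<and> \<not> stochastic U \<alpha> \<beta> \<omega>}"

end

theory Submission
  imports Defs
begin

text \<open>
  Upper bound: a unary program describes \<open>{\<omega>}\<close> with \<open>\<omega> + O(1)\<close> bits, so every nonstochastic \<open>\<omega>\<close>
  exceeds \<open>\<alpha> - O(1)\<close>; comparing \<open>m\<close> with its shifts absorbs the constant.

  Lower bound: spread \<open>m n\<close> over words of length \<open>(i + 1) \<cdot> gap N\<close>, where \<open>N = n + O(1)\<close> and the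
  scale \<open>i\<close> is uniform among \<open>2\<^sup>N\<^sup>+\<^sup>3\<close> many. There are fewer than \<open>2\<^sup>N\<^sup>+\<^sup>1\<close> sets of complexity at
  most \<open>N\<close>, and since \<open>gap N > 2 ^ (2 ^ N)\<close> each has a size critical for at most one scale. At a
  scale which is critical for none of them, the small sets together miss most words, and in the
  large ones every word of that scale has a randomness deficiency above \<open>\<beta>\<close>. Hence at least half
  of \<open>m n\<close> lands on nonstochastic objects, and the resulting semimeasure is dominated by \<open>m\<close>.
\<close>

section \<open>Total recursive functions\<close>

abbreviation total_recursive :: "(nat \<Rightarrow> nat) \<Rightarrow> bool" where
  "total_recursive f \<equiv> partial_recursive (\<lambda>x. Some (f x))"

abbreviation pfst :: "nat \<Rightarrow> nat" where
  "pfst z \<equiv> fst (prod_decode z)"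

abbreviation psnd :: "nat \<Rightarrow> nat" where
  "psnd z \<equiv> snd (prod_decode z)"

lemma total_recursive_comp:
  assumes "total_recursive f" "total_recursive g"
  shows "total_recursive (\<lambda>x. f (g x))"
  using partial_recursive.comp[OF assms] by simp

lemma total_recursive_pair:
  assumes "total_recursive f" "total_recursive g"
  shows "total_recursive (\<lambda>x. prod_encode (f x, g x))"
  using partial_recursive.pair[OF assms] by simp

lemma total_recursive_Suc:
  assumes "total_recursive f"
  shows "total_recursive (\<lambda>x. Suc (f x))"
  using total_recursive_comp[OF partial_recursive.succ assms] .

lemma total_recursive_pfst:
  assumes "total_recursive f"
  shows "total_recursive (\<lambda>x. pfst (f x))"
  using total_recursive_comp[OF partial_recursive.left assms] .

lemma total_recursive_psnd:
  assumes "total_recursive f"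
  shows "total_recursive (\<lambda>x. psnd (f x))"
  using total_recursive_comp[OF partial_recursive.right assms] .

lemma total_recursive_id: "total_recursive (\<lambda>x. x)"
  using total_recursive_pair[OF partial_recursive.left partial_recursive.right] by simp

lemma total_recursive_const: "total_recursive (\<lambda>x. c)"
  by (induction c) (auto intro: partial_recursive.zero total_recursive_Suc)

text \<open>With a total base and step the recursion never diverges. The argument \<open>x\<close>
  is carried along as parameter, which lets the step use other functions of \<open>x\<close>; the
  arithmetic below is iteration through this rule.\<close>

lemma total_recursive_rec_nat:
  assumes "total_recursive f" "total_recursive n"
    and G: "total_recursive (\<lambda>z. G (pfst z) (pfst (psnd z)) (psnd (psnd z)))"
  shows "total_recursive (\<lambda>x. rec_nat (f x) (G x) (n x))"
proof -
  let ?g = "\<lambda>z. G (pfst z) (pfst (psnd z)) (psnd (psnd z))"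
  have rec: "prim_rec (\<lambda>x. Some (f x)) (\<lambda>x. Some (?g x)) (prod_encode (a, k)) =
      Some (rec_nat (f a) (G a) k)" for a k
    by (induction k) (auto simp: prim_rec_def)
  show ?thesis
    using partial_recursive.comp[OF partial_recursive.prim_rec[OF assms(1) G]
        total_recursive_pair[OF total_recursive_id assms(2)]]
    by (simp add: rec)
qed

lemma total_recursive_add:
  assumes "total_recursive f" "total_recursive g"
  shows "total_recursive (\<lambda>x. f x + g x)"
proof -
  have "rec_nat a (\<lambda>_ r. Suc r) b = a + b" for a b :: nat
    by (induction b) auto
  then show ?thesis
    using total_recursive_rec_nat[OF assms, of "\<lambda>_ _ r. Suc r"]
    by (simp add: total_recursive_Suc total_recursive_psnd total_recursive_id)
qed

lemma total_recursive_mult: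
  assumes "total_recursive f" "total_recursive g"
  shows "total_recursive (\<lambda>x. f x * g x)"
proof -
  have "rec_nat 0 (\<lambda>_ r. a + r) b = a * b" for a b :: nat
    by (induction b) auto
  then show ?thesis
    using total_recursive_rec_nat[OF partial_recursive.zero assms(2), of "\<lambda>x _ r. f x + r"]
    by (simp add: total_recursive_add total_recursive_psnd total_recursive_id
        total_recursive_comp[OF assms(1) partial_recursive.left])
qed

lemma total_recursive_power:
  assumes "total_recursive f" "total_recursive g"
  shows "total_recursive (\<lambda>x. f x ^ g x)"
proof -
  have "rec_nat 1 (\<lambda>_ r. a * r) b = a ^ b" for a b :: nat
    by (induction b) auto
  then show ?thesis
    using total_recursive_rec_nat[OF total_recursive_const[of 1] assms(2), of "\<lambda>x _ r. f x * r"]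
    by (simp add: total_recursive_mult total_recursive_psnd total_recursive_id
        total_recursive_comp[OF assms(1) partial_recursive.left])
qed

lemma total_recursive_diff:
  assumes "total_recursive f" "total_recursive g"
  shows "total_recursive (\<lambda>x. f x - g x)"
proof -
  \<comment> \<open>Returning the counter yields the predecessor, whose iteration is truncated
    subtraction.\<close>
  have "rec_nat 0 (\<lambda>k _. k) a = a - 1" for a :: nat
    by (cases a) auto
  then have pred: "total_recursive (\<lambda>a. a - 1)"
    using total_recursive_rec_nat[OF partial_recursive.zero total_recursive_id, of "\<lambda>_ k _. k"]
    by (simp add: total_recursive_pfst total_recursive_psnd total_recursive_id)
  have "rec_nat a (\<lambda>_ r. r - 1) b = a - b" for a b :: nat
    by (induction b) auto
  then show ?thesis
    using total_recursive_rec_nat[OF assms, of "\<lambda>_ _ r. r - 1"]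
      total_recursive_comp[OF pred total_recursive_psnd[OF partial_recursive.right]]
    by simp
qed

lemma total_recursive_if_le:
  assumes "total_recursive f" "total_recursive g" "total_recursive h" "total_recursive k"
  shows "total_recursive (\<lambda>x. if f x \<le> g x then h x else k x)"
proof -
  \<comment> \<open>Branching is a recursion whose step ignores its arguments; its length
    \<open>f x - g x\<close> is 0 exactly when the first branch applies.\<close>
  have "rec_nat a (\<lambda>_ _. b) c = (if c = 0 then a else b)" for a b c :: nat
    by (cases c) auto
  then show ?thesis
    using total_recursive_rec_nat[OF assms(3) total_recursive_diff[OF assms(1,2)], of "\<lambda>x _ _. k x"]
      total_recursive_comp[OF assms(4) partial_recursive.left]
    by simp
qed

lemma total_recursive_Least:
  assumes F: "total_recursive (\<lambda>z. F (pfst z) (psnd z))"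
    and ex: "\<And>x. \<exists>n. F x n = 0"
  shows "total_recursive (\<lambda>x. LEAST n. F x n = 0)"
proof -
  have "minimize (\<lambda>z. Some (F (pfst z) (psnd z))) = (\<lambda>x. Some (LEAST n. F x n = 0))"
  proof
    fix x
    have "F x (LEAST n. F x n = 0) = 0"
      using LeastI_ex[OF ex] .
    moreover have "\<exists>v. F x k = Suc v" if "k < (LEAST n. F x n = 0)" for k
      using not_less_Least[OF that] by (cases "F x k") auto
    ultimately show "minimize (\<lambda>z. Some (F (pfst z) (psnd z))) x = Some (LEAST n. F x n = 0)"
      by (auto simp: minimize_def)
  qed
  then show ?thesis
    using partial_recursive.minimize[OF F] by simp
qed

text \<open>Conditional divergence: a search over an argument that its test ignores stops at once or
  never.\<close>

lemma partial_recursive_restrict: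
  assumes "total_recursive h" "total_recursive f" "total_recursive g"
  shows "partial_recursive (\<lambda>x. if f x = g x then Some (h x) else None)"
proof -
  \<comment> \<open>Truncated subtraction both ways gives the distance, which is zero exactly on
    equality.\<close>
  let ?c = "\<lambda>x. (f x - g x) + (g x - f x)"
  let ?d = "minimize (\<lambda>z. Some (?c (pfst z)))"
  have c: "total_recursive ?c"
    by (intro total_recursive_add total_recursive_diff assms)
  have d: "?d x = (if f x = g x then Some 0 else None)" for x
    by (auto simp: minimize_def)
  \<comment> \<open>Pairing with \<open>?d x\<close> imports its divergence; the projection then
    discards its value.\<close>
  let ?e = "\<lambda>x. Option.bind
      (Option.bind (Some (h x)) (\<lambda>u. Option.bind (?d x) (\<lambda>v. Some (prod_encode (u, v)))))
      (\<lambda>z. Some (pfst z))"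
  have "partial_recursive ?e"
    by (intro partial_recursive.comp partial_recursive.pair partial_recursive.left assms(1)
        partial_recursive.minimize total_recursive_comp[OF c])
  moreover have "?e = (\<lambda>x. if f x = g x then Some (h x) else None)"
    by (auto simp: d)
  ultimately show ?thesis
    by simp
qed

lemmas total_recursive_intros =
  total_recursive_id total_recursive_const total_recursive_pfst total_recursive_psnd
  total_recursive_pair total_recursive_Suc total_recursive_add total_recursive_mult
  total_recursive_diff total_recursive_power total_recursive_if_le

section \<open>Lower semicomputable functions\<close>

lemma computable2_iff: "computable2 h \<longleftrightarrow> total_recursive (\<lambda>z. h (pfst z) (psnd z))"
  by (simp add: computable2_def case_prod_beta)

text \<open>Composing with \<open>\<phi>\<close> and multiplying by a nonnegative rational weight
  keeps the approximating fractions monotone. The values of \<open>\<phi>\<close> must avoid 0,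
  where nothing is known about \<open>f\<close>.\<close>

lemma lower_semicomputable_reweight:
  assumes "lower_semicomputable f"
    and "total_recursive \<phi>" "total_recursive u" "total_recursive w"
    and pos: "\<And>n. \<phi> n \<ge> 1" "\<And>n. w n > 0"
  shows "lower_semicomputable (\<lambda>n. f (\<phi> n) * (real (u n) / real (w n)))"
proof -
  obtain p q where "computable2 p" "computable2 q"
    and q: "\<And>n k. n \<ge> 1 \<Longrightarrow> q n k > 0"
    and mono: "\<And>n. n \<ge> 1 \<Longrightarrow> incseq (\<lambda>k. real (p n k) / real (q n k))"
    and lim: "\<And>n. n \<ge> 1 \<Longrightarrow> (\<lambda>k. real (p n k) / real (q n k)) \<longlonglongrightarrow> f n"
    using assms(1) unfolding lower_semicomputable_def by blast
  have pair: "total_recursive (\<lambda>z. prod_encode (\<phi> (pfst z), psnd z))"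
    by (intro total_recursive_intros total_recursive_comp[OF assms(2)])
  have comp: "computable2 (\<lambda>n k. r (\<phi> n) k * v n)" if "computable2 r" "total_recursive v" for r v
    unfolding computable2_iff
    using total_recursive_comp[OF that(1)[unfolded computable2_iff] pair]
    by (intro total_recursive_mult total_recursive_comp[OF that(2)] total_recursive_intros) simp
  have eq: "real (p (\<phi> n) k * u n) / real (q (\<phi> n) k * w n) =
      real (p (\<phi> n) k) / real (q (\<phi> n) k) * (real (u n) / real (w n))" for n k
    by simp
  show ?thesis
    unfolding lower_semicomputable_def
  proof (intro exI conjI allI impI)
    show "computable2 (\<lambda>n k. p (\<phi> n) k * u n)" "computable2 (\<lambda>n k. q (\<phi> n) k * w n)"
      by (intro comp \<open>computable2 p\<close> \<open>computable2 q\<close> assms)+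
    fix n
    show "q (\<phi> n) k * w n > 0" for k
      using q pos by simp
    show "incseq (\<lambda>k. real (p (\<phi> n) k * u n) / real (q (\<phi> n) k * w n))"
      unfolding eq using mono[OF pos(1)] unfolding incseq_def
      by (intro allI impI mult_right_mono) (blast, simp)
    show "(\<lambda>k. real (p (\<phi> n) k * u n) / real (q (\<phi> n) k * w n)) \<longlonglongrightarrow>
        f (\<phi> n) * (real (u n) / real (w n))"
      unfolding eq by (intro tendsto_mult lim pos tendsto_const)
  qed
qed

section \<open>Machines with a unary header\<close>

definition hd_code :: "nat \<Rightarrow> nat" where
  "hd_code c = pfst (c - 1)"

definition tl_code :: "nat \<Rightarrow> nat" where
  "tl_code c = psnd (c - 1)"

definition drop_code :: "nat \<Rightarrow> nat \<Rightarrow> nat" where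
  "drop_code c k = rec_nat c (\<lambda>_. tl_code) k"

definition length_code :: "nat \<Rightarrow> nat" where
  "length_code c = (LEAST k. drop_code c k = 0)"

text \<open>Beyond the end of the list the head reads 0, so on a program of ones only the search
  stops at its length, in agreement with \<open>header\<close> below.\<close>

definition header_code :: "nat \<Rightarrow> nat" where
  "header_code c = (LEAST k. hd_code (drop_code c k) = 0)"

lemma prod_decode_0 [simp]: "prod_decode 0 = (0, 0)"
  by (simp add: prod_decode_def prod_decode_aux.simps)

lemma drop_code_list_encode: "drop_code (list_encode xs) k = list_encode (drop k xs)"
proof (induction k)
  case (Suc k)
  have "tl_code (list_encode ys) = list_encode (tl ys)" for ys
    by (cases ys) (auto simp: tl_code_def)
  with Suc show ?case
    by (simp add: drop_code_def drop_Suc drop_tl)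
qed (simp add: drop_code_def)

lemma list_encode_eq_0 [simp]: "list_encode xs = 0 \<longleftrightarrow> xs = []"
  by (cases xs) auto

lemma length_code_list_encode: "length_code (list_encode xs) = length xs"
  unfolding length_code_def drop_code_list_encode
  by (rule Least_equality) auto

text \<open>Every number codes a list; this makes the searches in \<open>length_code\<close> and
  \<open>header_code\<close> total.\<close>

lemma drop_code_eventually_0: "\<exists>k. drop_code c k = 0"
  using drop_code_list_encode[of "list_decode c" "length (list_decode c)"] by auto

lemma total_recursive_hd_code:
  "total_recursive f \<Longrightarrow> total_recursive (\<lambda>x. hd_code (f x))"
  unfolding hd_code_def by (intro total_recursive_intros)

lemma total_recursive_drop_code:
  assumes "total_recursive f" "total_recursive g"
  shows "total_recursive (\<lambda>x. drop_code (f x) (g x))"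
  unfolding drop_code_def tl_code_def
  by (intro total_recursive_rec_nat total_recursive_intros assms)

lemma total_recursive_length_code: "total_recursive length_code"
  unfolding length_code_def
  by (intro total_recursive_Least drop_code_eventually_0 total_recursive_drop_code
      total_recursive_intros)

lemma total_recursive_header_code: "total_recursive header_code"
  unfolding header_code_def
proof (intro total_recursive_Least total_recursive_hd_code total_recursive_drop_code
      total_recursive_intros)
  show "\<exists>k. hd_code (drop_code c k) = 0" for c
    using drop_code_eventually_0[of c] by (metis hd_code_def diff_0_eq_0 fst_conv prod_decode_0)
qed

text \<open>
  A valid program is \<open>1\<^sup>a 0 r\<close> with \<open>length r = g a\<close>; it is self-delimiting provided \<open>g a > 0\<close>,
  which excludes the program consisting of ones only.
\<close>

definition header :: "bool list \<Rightarrow> nat" where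
  "header p = length (takeWhile id p)"

definition payload :: "bool list \<Rightarrow> bool list" where
  "payload p = drop (Suc (header p)) p"

definition header_machine :: "(nat \<Rightarrow> nat) \<Rightarrow> (nat \<Rightarrow> nat \<Rightarrow> nat) \<Rightarrow> machine" where
  "header_machine g h p y =
     (if length (payload p) = g (header p) then Some (h (header p) (bits_code (payload p)))
      else None)"

lemma header_code_bits_code: "header_code (bits_code p) = header p"
  unfolding header_code_def bits_code_def drop_code_list_encode
proof (rule Least_equality)
  show "hd_code (list_encode (drop (header p) (map of_bool p))) = 0"
    by (induction p) (auto simp: header_def hd_code_def)
  show "header p \<le> k" if "hd_code (list_encode (drop k (map of_bool p))) = 0" for k
    using that
  proof (induction p arbitrary: k)
    case (Cons b p)
    then show ?case
      by (cases k) (auto simp: header_def hd_code_def)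
  qed (simp add: header_def)
qed

lemma payload_code: "drop_code (bits_code p) (Suc (header p)) = bits_code (payload p)"
  by (simp add: bits_code_def drop_code_list_encode payload_def drop_map)

lemma header_program [simp]: "header (replicate a True @ False # r) = a"
  by (induction a) (auto simp: header_def)

lemma payload_program [simp]: "payload (replicate a True @ False # r) = r"
  by (simp add: payload_def)

lemma payload_nonempty:
  assumes "payload p \<noteq> []"
  shows "p = replicate (header p) True @ False # payload p"
  using assms
proof (induction p)
  case (Cons b p)
  then show ?case
    by (cases b) (auto simp: header_def payload_def)
qed (simp add: payload_def)

text \<open>The first zero fixes the header, and the header fixes the payload length; a proper
  extension of a valid program keeps the header, but its payload is too long.\<close>

lemma prefix_free_header_machine:
  assumes g: "total_recursive g" "\<And>a. g a > 0"
    and h: "total_recursive (\<lambda>z. h (pfst z) (psnd z))"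
  shows "prefix_free_machine (header_machine g h)"
  unfolding prefix_free_machine_def
proof (intro conjI allI impI)
  let ?hd = "\<lambda>z. header_code (pfst z)"
  let ?pl = "\<lambda>z. drop_code (pfst z) (Suc (?hd z))"
  have hd: "total_recursive ?hd"
    by (rule total_recursive_comp[OF total_recursive_header_code partial_recursive.left])
  have pl: "total_recursive ?pl"
    by (intro total_recursive_drop_code total_recursive_Suc hd total_recursive_intros)
  have out: "total_recursive (\<lambda>z. h (?hd z) (?pl z))"
    using total_recursive_comp[OF h total_recursive_pair[OF hd pl]] by simp
  let ?f = "\<lambda>z. if length_code (?pl z) = g (?hd z) then Some (h (?hd z) (?pl z)) else None"
  have "partial_recursive ?f"
    by (rule partial_recursive_restrict[OF out
          total_recursive_comp[OF total_recursive_length_code pl] total_recursive_comp[OF g(1) hd]])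
  moreover have "length_code (bits_code p) = length p" for p
    by (simp add: bits_code_def length_code_list_encode)
  then have "header_machine g h p y = ?f (prod_encode (bits_code p, y))" for p y
    by (simp add: header_machine_def header_code_bits_code payload_code)
  ultimately show "computable_machine (header_machine g h)"
    unfolding computable_machine_def by (intro exI[of _ ?f]) blast
next
  fix y p q
  assume "header_machine g h p y \<noteq> None \<and> header_machine g h q y \<noteq> None \<and> prefix p q"
  then have len: "length (payload p) = g (header p)" "length (payload q) = g (header q)"
    and "prefix p q"
    by (auto simp: header_machine_def split: if_splits)
  then obtain s where s: "q = p @ s"
    by (auto simp: prefix_def)
  \<comment> \<open>Positivity of \<open>g\<close> ensures that the header of \<open>p\<close> ends
    inside \<open>p\<close>, so that \<open>q\<close> inherits it.\<close>
  have "payload p \<noteq> []"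
    using len(1) g(2)[of "header p"] by auto
  from payload_nonempty[OF this] have q: "q = replicate (header p) True @ False # (payload p @ s)"
    unfolding s by (metis append.assoc append_Cons)
  have "header q = header p" "payload q = payload p @ s"
    by (subst q, simp)+
  with len have "s = []"
    by simp
  with s show "p = q"
    by simp
qed

section \<open>Complexity bounds and the number of simple sets\<close>

lemma cond_complexity_le:
  assumes "M p y = Some x"
  shows "cond_complexity M x y \<le> enat (length p)"
  unfolding cond_complexity_def using assms by (intro INF_lower) auto

lemma cond_complexity_header_machine:
  assumes "length r = g a"
  shows "cond_complexity (header_machine g h) (h a (bits_code r)) y \<le> enat (a + 1 + g a)"
  using cond_complexity_le[of "header_machine g h" "replicate a True @ False # r"] assms
  by (simp add: header_machine_def)

text \<open>Header machines ignore the condition, so one constant serves all conditions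
  \<open>y\<close>.\<close>

lemma optimal_complexity_le_header:
  assumes "optimal_prefix_free_machine U"
    and "total_recursive g" "\<And>a. g a > 0" "total_recursive (\<lambda>z. h (pfst z) (psnd z))"
  obtains C where "\<And>a r y. length r = g a \<Longrightarrow>
    cond_complexity U (h a (bits_code r)) y \<le> enat (a + 1 + g a + C)"
proof -
  obtain C where C: "\<And>x y. cond_complexity U x y \<le> cond_complexity (header_machine g h) x y + enat C"
    using assms prefix_free_header_machine[OF assms(2-4)]
    unfolding optimal_prefix_free_machine_def by blast
  show ?thesis
  proof (rule that)
    fix a y and r :: "bool list"
    assume "length r = g a"
    then have "cond_complexity (header_machine g h) (h a (bits_code r)) y + enat C
        \<le> enat (a + 1 + g a) + enat C"
      by (intro add_right_mono cond_complexity_header_machine)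
    with C show "cond_complexity U (h a (bits_code r)) y \<le> enat (a + 1 + g a + C)"
      by (metis order_trans plus_enat_simps(1))
  qed
qed

text \<open>A finite set is recovered from its code, so these sets are images of words of length at
  most \<open>N\<close>.\<close>

lemma card_sets_of_complexity_le:
  fixes U :: machine and N :: nat
  defines "S \<equiv> {\<Omega>. finite \<Omega> \<and> complexity U (set_code \<Omega>) \<le> enat N}"
  shows "finite S" "card S \<le> 2 ^ (N + 1)"
proof -
  let ?P = "{p :: bool list. set p \<subseteq> UNIV \<and> length p \<le> N}"
  define dec where "dec p = set (list_decode (the (U p 0)))" for p
  have sub: "S \<subseteq> dec ` ?P"
  proof
    fix \<Omega>
    assume "\<Omega> \<in> S"
    then have fin: "finite \<Omega>" and le: "cond_complexity U (set_code \<Omega>) 0 \<le> enat N"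
      by (auto simp: S_def complexity_def)
    \<comment> \<open>Otherwise all programs for the code have length at least \<open>Suc N\<close>,
      and so their infimum is at least \<open>Suc N\<close>.\<close>
    have "\<exists>p. U p 0 = Some (set_code \<Omega>) \<and> length p \<le> N"
    proof (rule ccontr)
      assume "\<not> ?thesis"
      then have "enat (Suc N) \<le> cond_complexity U (set_code \<Omega>) 0"
        unfolding cond_complexity_def by (intro INF_greatest) (auto simp: not_le)
      with le show False
        using order_trans by fastforce
    qed
    then obtain p where "U p 0 = Some (set_code \<Omega>)" "length p \<le> N"
      by blast
    with fin show "\<Omega> \<in> dec ` ?P"
      by (intro image_eqI[of _ _ p]) (auto simp: dec_def set_code_def)
  qed
  have fin: "finite ?P"
    by (rule finite_lists_length_le) simp
  then show "finite S"
    using sub finite_surj by blast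
  have "card S \<le> card ?P"
    using surj_card_le[OF fin sub] .
  also have "card ?P = (\<Sum>i\<le>N. 2 ^ i)"
    by (subst card_lists_length_le) simp_all
  also have "\<dots> \<le> 2 ^ (N + 1)"
    by (induction N) auto
  finally show "card S \<le> 2 ^ (N + 1)" .
qed

section \<open>The upper bound\<close>

lemma universal_semimeasureD:
  assumes "universal_semimeasure m"
  shows "\<And>n. n \<ge> 1 \<Longrightarrow> 0 \<le> m n" "m summable_on {1..}" "(\<Sum>\<^sub>\<infinity>n\<in>{1..}. m n) \<le> 1"
    "lower_semicomputable m"
  using assms by (auto simp: universal_semimeasure_def semimeasure_def)

lemma universal_semimeasure_dominates:
  assumes "universal_semimeasure m" "semimeasure f" "lower_semicomputable f"
  obtains C where "C > 0" "\<And>n. n \<ge> 1 \<Longrightarrow> f n \<le> C * m n"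
  using assms unfolding universal_semimeasure_def by blast

lemma semimeasure_finite_sums:
  assumes "\<And>n. n \<ge> 1 \<Longrightarrow> 0 \<le> f n"
    and "\<And>F. finite F \<Longrightarrow> F \<subseteq> {1..} \<Longrightarrow> sum f F \<le> 1"
  shows "semimeasure f"
proof -
  have "f summable_on {1..}"
    using assms by (intro nonneg_bdd_above_summable_on) (auto intro!: bdd_aboveI)
  then show ?thesis
    unfolding semimeasure_def using assms by (auto intro: infsum_le_finite_sums)
qed

text \<open>Together with \<open>mass_leI\<close> this reduces the estimates of masses to finite
  sums.\<close>

lemma sum_universal_semimeasure_le_mass:
  assumes "universal_semimeasure m" "finite F" "F \<subseteq> A" "A \<subseteq> {1..}"
  shows "sum m F \<le> mass m A"
  unfolding mass_def
  using assms universal_semimeasureD[OF assms(1)]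
  by (intro finite_sum_le_infsum) (auto intro: summable_on_subset_banach)

lemma mass_leI:
  assumes "universal_semimeasure m" "A \<subseteq> {1..}"
    and "\<And>F. finite F \<Longrightarrow> F \<subseteq> A \<Longrightarrow> sum m F \<le> b"
  shows "mass m A \<le> b"
  unfolding mass_def
  using assms universal_semimeasureD[OF assms(1)]
  by (intro infsum_le_finite_sums) (auto intro: summable_on_subset_banach)

text \<open>The shift of \<open>m\<close> by \<open>d\<close>, extended by zero, is itself a lower
  semicomputable semimeasure and hence dominated by \<open>m\<close>.\<close>

lemma universal_semimeasure_shift:
  assumes m: "universal_semimeasure m"
  obtains C where "C > 0" "\<And>n. n \<ge> 1 \<Longrightarrow> m n \<le> C * m (n + d)"
proof -
  \<comment> \<open>\<open>n - Suc d + 1\<close> is \<open>n - d\<close> for \<open>n > d\<close>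
    and 1 otherwise, hence never 0; the weight removes the second case.\<close>
  define f where "f n = m (n - Suc d + 1) *
      (real (if Suc d \<le> n then 1 else 0) / real 1)" for n
  have f: "f n = (if Suc d \<le> n then m (n - d) else 0)" for n
    by (auto simp: f_def Suc_diff_le Suc_diff_Suc)
  have "lower_semicomputable f"
    unfolding f_def
    by (intro lower_semicomputable_reweight universal_semimeasureD(4)[OF m] total_recursive_intros)
      auto
  moreover have "semimeasure f"
  proof (rule semimeasure_finite_sums)
    show "0 \<le> f n" for n
      using universal_semimeasureD(1)[OF m] by (auto simp: f)
    show "sum f F \<le> 1" if "finite F" "F \<subseteq> {1..}" for F
    proof -
      let ?F = "{n \<in> F. Suc d \<le> n}"
      have "sum f F = (\<Sum>n\<in>?F. m (n - d))"
        using that by (intro sum.mono_neutral_cong_right) (auto simp: f)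
      also have "\<dots> = sum m ((\<lambda>n. n - d) ` ?F)"
        by (subst sum.reindex) (auto simp: inj_on_def)
      also have "\<dots> \<le> mass m {1..}"
        using that by (intro sum_universal_semimeasure_le_mass[OF m]) auto
      also have "\<dots> \<le> 1"
        using universal_semimeasureD(3)[OF m] by (simp add: mass_def)
      finally show ?thesis .
    qed
  qed
  ultimately obtain C where "C > 0" and C: "\<And>n. n \<ge> 1 \<Longrightarrow> f n \<le> C * m n"
    using universal_semimeasure_dominates[OF m] by metis
  have "m n \<le> C * m (n + d)" if "n \<ge> 1" for n
    using that C[of "n + d"] by (simp add: f)
  with \<open>C > 0\<close> show ?thesis
    by (rule that)
qed

text \<open>For a singleton model the logarithm vanishes and typicality is automatic, so only the
  complexity of the model matters.\<close>

lemma mass_nonstochastic_le: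
  assumes m: "universal_semimeasure m" and U: "optimal_prefix_free_machine U"
  obtains c where "c > 0" "\<And>\<alpha> \<beta>. mass m (nonstochastic_set U \<alpha> \<beta>) \<le> c * tau m \<alpha>"
proof -
  have "total_recursive (\<lambda>z. list_encode [pfst z])"
    by (simp, intro total_recursive_intros)
  \<comment> \<open>The header is the number itself; the payload is one dummy bit, since payload
    lengths must be positive.\<close>
  then obtain C where "cond_complexity U (list_encode [a]) y \<le> enat (a + 1 + 1 + C)"
    if "length r = 1" for a y and r :: "bool list"
    using optimal_complexity_le_header[OF U total_recursive_const[of 1], of "\<lambda>a _. list_encode [a]"]
    by (metis zero_less_one)
  from this[of "[True]"]
  have C: "complexity U (set_code {a}) \<le> enat (a + (C + 2))" for a
    by (simp add: complexity_def set_code_def)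
  define d where "d = C + 2"
  obtain c where c: "c > 0" "\<And>n. n \<ge> 1 \<Longrightarrow> m n \<le> c * m (n + d)"
    using universal_semimeasure_shift[OF m] by metis
  show ?thesis
  proof (rule that[OF c(1)])
    fix \<alpha> \<beta>
    have gt: "\<alpha> < \<omega> + d" if "\<omega> \<in> nonstochastic_set U \<alpha> \<beta>" for \<omega>
    proof (rule ccontr)
      assume "\<not> \<alpha> < \<omega> + d"
      then have "complexity U (set_code {\<omega>}) \<le> enat \<alpha>"
        using C[of \<omega>] by (auto simp: d_def intro: order_trans)
      moreover have "ereal (log 2 (real (card {\<omega>})) - real \<beta>)
          \<le> ereal_of_enat (cond_complexity U \<omega> (set_code {\<omega>}))"
        by (rule order_trans[of _ 0]) auto
      ultimately have "stochastic U \<alpha> \<beta> \<omega>"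
        using that unfolding stochastic_def nonstochastic_set_def
        by (intro exI[of _ "{\<omega>}"]) auto
      with that show False
        by (simp add: nonstochastic_set_def)
    qed
    show "mass m (nonstochastic_set U \<alpha> \<beta>) \<le> c * tau m \<alpha>"
    proof (rule mass_leI[OF m])
      show "nonstochastic_set U \<alpha> \<beta> \<subseteq> {1..}"
        by (auto simp: nonstochastic_set_def)
      fix F
      assume F: "finite F" "F \<subseteq> nonstochastic_set U \<alpha> \<beta>"
      \<comment> \<open>Moving every element up by \<open>d\<close> lands above
        \<open>\<alpha>\<close> at the cost of the factor \<open>c\<close>.\<close>
      have "sum m F \<le> (\<Sum>n\<in>F. c * m (n + d))"
        using F by (intro sum_mono c(2)) (auto simp: nonstochastic_set_def)
      also have "\<dots> = c * sum m ((\<lambda>n. n + d) ` F)"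
        by (subst sum.reindex) (auto simp: sum_distrib_left)
      also have "\<dots> \<le> c * tau m \<alpha>"
        unfolding tau_def using F c(1) gt
        by (intro mult_left_mono sum_universal_semimeasure_le_mass[OF m])
          (auto simp: Suc_le_eq subset_iff)
      finally show "sum m F \<le> c * tau m \<alpha>" .
    qed
  qed
qed

section \<open>The lower bound\<close>

definition word_value :: "nat \<Rightarrow> nat \<Rightarrow> nat" where
  "word_value c l = rec_nat 0 (\<lambda>k s. s + hd_code (drop_code c k) * 2 ^ k) l"

lemma word_value_bits_code:
  assumes "l \<le> length r"
  shows "word_value (bits_code r) l = (\<Sum>k<l. of_bool (r ! k) * 2 ^ k)"
proof -
  have "hd_code (drop_code (bits_code r) k) = of_bool (r ! k)" if "k < length r" for k
    using that
    by (simp add: hd_code_def bits_code_def drop_code_list_encode flip: Cons_nth_drop_Suc)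
  with assms show ?thesis
    by (induction l) (auto simp: word_value_def)
qed

lemma word_value_surj:
  assumes "v < 2 ^ l"
  obtains r where "length r = l" "word_value (bits_code r) l = v"
proof
  \<comment> \<open>The binary digits of \<open>v\<close>, least significant first, as
    \<open>word_value\<close> weighs them.\<close>
  let ?r = "map (bit v) [0..<l]"
  show "length ?r = l"
    by simp
  have "word_value (bits_code ?r) l = horner_sum of_bool 2 ?r"
    by (subst word_value_bits_code) (auto simp: horner_sum_eq_sum atLeast0LessThan)
  also have "\<dots> = v"
    using assms by (simp add: horner_sum_bit_eq_take_bit take_bit_nat_eq_self)
  finally show "word_value (bits_code ?r) l = v" .
qed

lemma total_recursive_word_value:
  assumes "total_recursive f" "total_recursive g"
  shows "total_recursive (\<lambda>x. word_value (f x) (g x))"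
  unfolding word_value_def
  by (intro total_recursive_rec_nat total_recursive_hd_code total_recursive_drop_code
      total_recursive_intros total_recursive_comp[OF assms(1)] assms)

definition scales :: "nat \<Rightarrow> nat" where
  "scales N = 2 ^ (N + 3)"

text \<open>
  The gap between consecutive scales exceeds \<open>\<beta>\<close>, the length of the header describing the scale
  and the logarithm of the number of scales, so that the size of a model is critical for at most
  one scale.
\<close>

definition gap :: "nat \<Rightarrow> nat" where
  "gap N = 2 ^ (2 ^ N) + prod_encode (N, scales N) + 2 * N + 4"

definition width :: "nat \<Rightarrow> nat \<Rightarrow> nat" where
  "width N i = Suc i * gap N"

text \<open>\<open>N\<close> and \<open>i\<close> are part of the object, so that different scales
  never share a point; the successor avoids 0.\<close>

definition point :: "nat \<Rightarrow> nat \<Rightarrow> nat \<Rightarrow> nat" where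
  "point N i v = Suc (prod_encode (prod_encode (N, i), v))"

lemma point_eq_iff [simp]: "point N i v = point N' i' v' \<longleftrightarrow> N = N' \<and> i = i' \<and> v = v'"
  by (auto simp: point_def)

lemma point_ge_1 [simp]: "Suc 0 \<le> point N i v"
  by (simp add: point_def)

lemma total_recursive_scales: "total_recursive f \<Longrightarrow> total_recursive (\<lambda>x. scales (f x))"
  unfolding scales_def by (intro total_recursive_intros)

lemma total_recursive_width:
  assumes "total_recursive f" "total_recursive g"
  shows "total_recursive (\<lambda>x. width (f x) (g x))"
  unfolding width_def gap_def by (intro total_recursive_intros total_recursive_scales assms)

text \<open>The program has the code of \<open>(N, i)\<close> in unary as header and the binary
  digits of \<open>v\<close> as payload.\<close>

lemma complexity_point_le:
  assumes U: "optimal_prefix_free_machine U"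
  obtains C where "\<And>N i v y. v < 2 ^ width N i \<Longrightarrow>
    cond_complexity U (point N i v) y \<le> enat (prod_encode (N, i) + 1 + width N i + C)"
proof -
  define g where "g a = width (pfst a) (psnd a)" for a
  define h where "h a c = Suc (prod_encode (a, word_value c (g a)))" for a c
  have "total_recursive g"
    unfolding g_def by (intro total_recursive_width total_recursive_intros)
  moreover have "g a > 0" for a
    by (simp add: g_def width_def gap_def)
  moreover have "total_recursive (\<lambda>z. h (pfst z) (psnd z))"
    unfolding h_def
    by (intro total_recursive_intros total_recursive_word_value
        total_recursive_comp[OF \<open>total_recursive g\<close>])
  ultimately obtain C where C: "\<And>a r y. length r = g a \<Longrightarrow>
      cond_complexity U (h a (bits_code r)) y \<le> enat (a + 1 + g a + C)"
    using optimal_complexity_le_header[OF U, of g h] by metis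
  show ?thesis
  proof (rule that)
    fix N i v y :: nat
    assume "v < 2 ^ width N i"
    then obtain r where "length r = width N i" "word_value (bits_code r) (width N i) = v"
      by (rule word_value_surj)
    then show "cond_complexity U (point N i v) y \<le> enat (prod_encode (N, i) + 1 + width N i + C)"
      using C[of r "prod_encode (N, i)" y] by (simp add: g_def h_def point_def)
  qed
qed

section \<open>Models of a point and critical scales\<close>

lemma card_le_of_log_le:
  assumes "log 2 (real c) \<le> real k" "c > 0"
  shows "c \<le> 2 ^ k"
proof -
  have "real c \<le> 2 powr real k"
    using assms by (simp add: log_le_iff)
  then have "real c \<le> real (2 ^ k)"
    by (simp add: powr_realpow)
  then show ?thesis
    by (simp only: of_nat_le_iff)
qed

text \<open>The complexity of the point is not much more than \<open>width N i\<close>, and a model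
  in which its deficiency is at most \<open>\<beta>\<close> has logarithmic size at most
  \<open>\<beta>\<close> above that complexity.\<close>

lemma model_of_point_small:
  assumes K: "cond_complexity U (point N i v) (set_code \<Omega>)
      \<le> enat (prod_encode (N, i) + 1 + width N i + C)"
    and "C \<le> N" "i < scales N" "\<beta> \<le> 2 ^ (2 ^ N)"
    and \<Omega>: "finite \<Omega>" "point N i v \<in> \<Omega>"
    and le: "ereal (log 2 (real (card \<Omega>)) - real \<beta>)
      \<le> ereal_of_enat (cond_complexity U (point N i v) (set_code \<Omega>))"
  shows "card \<Omega> * 2 ^ (N + 3) \<le> 2 ^ (width N i + gap N)"
proof -
  define e where "e = prod_encode (N, i) + 1 + width N i + C"
  have "ereal (log 2 (real (card \<Omega>)) - real \<beta>) \<le> ereal_of_enat (enat e)"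
    using le K unfolding e_def by (meson ereal_of_enat_le_iff order_trans)
  then have "log 2 (real (card \<Omega>)) \<le> real (\<beta> + e)"
    by simp
  moreover have "card \<Omega> > 0"
    using \<Omega> by (auto simp: card_gt_0_iff)
  ultimately have "card \<Omega> \<le> 2 ^ (\<beta> + e)"
    by (rule card_le_of_log_le)
  then have "card \<Omega> * 2 ^ (N + 3) \<le> 2 ^ (\<beta> + e + (N + 3))"
    by (subst power_add) (rule mult_right_mono, auto)
  also have "prod_encode (N, i) \<le> prod_encode (N, scales N)"
    using assms(3)
    by (simp add: prod_encode_def triangle_def add_le_mono div_le_mono mult_le_mono)
  \<comment> \<open>In \<open>gap N\<close> the tower covers \<open>\<beta>\<close>, the pair code
    covers the header, one \<open>N\<close> covers \<open>C\<close>, and \<open>N + 4\<close> is the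
    remaining \<open>1 + (N + 3)\<close>.\<close>
  then have "\<beta> + e + (N + 3) \<le> width N i + gap N"
    using assms(2,4) by (simp add: e_def gap_def)
  then have "(2::nat) ^ (\<beta> + e + (N + 3)) \<le> 2 ^ (width N i + gap N)"
    by (rule power_increasing) simp
  finally show ?thesis .
qed

text \<open>The window of critical sizes: models above it are excluded by
  \<open>model_of_point_small\<close>, those below it are so small that together they cover few
  words.\<close>

definition spoils :: "nat \<Rightarrow> nat set \<Rightarrow> nat \<Rightarrow> bool" where
  "spoils N \<Omega> i \<longleftrightarrow> 2 ^ width N i < card \<Omega> * 2 ^ (N + 3) \<and>
     card \<Omega> * 2 ^ (N + 3) \<le> 2 ^ (width N i + gap N)"

text \<open>\<open>width N\<close> grows in steps of \<open>gap N\<close>, so the windows of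
  consecutive scales only touch; open below and closed above, they are disjoint.\<close>

lemma spoils_unique:
  assumes "spoils N \<Omega> i" "spoils N \<Omega> j"
  shows "i = j"
proof -
  have False if "a < b" "spoils N \<Omega> a" "spoils N \<Omega> b" for a b
  proof -
    have "width N a + gap N = Suc (Suc a) * gap N"
      by (simp add: width_def)
    also have "\<dots> \<le> width N b"
      unfolding width_def using that(1) by (intro mult_right_mono) auto
    finally have "(2::nat) ^ (width N a + gap N) \<le> 2 ^ width N b"
      by (rule power_increasing) simp
    with that(2,3) show False
      by (auto simp: spoils_def)
  qed
  with assms show ?thesis
    by (meson linorder_neqE_nat)
qed

lemma card_spoiled:
  assumes "finite S"
  shows "finite {i. \<exists>\<Omega>\<in>S. spoils N \<Omega> i}" "card {i. \<exists>\<Omega>\<in>S. spoils N \<Omega> i} \<le> card S"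
proof -
  have sub: "{i. \<exists>\<Omega>\<in>S. spoils N \<Omega> i} \<subseteq> (\<lambda>\<Omega>. THE i. spoils N \<Omega> i) ` S"
  proof
    fix i
    assume "i \<in> {i. \<exists>\<Omega>\<in>S. spoils N \<Omega> i}"
    then obtain \<Omega> where \<Omega>: "\<Omega> \<in> S" "spoils N \<Omega> i"
      by blast
    then have "(THE i. spoils N \<Omega> i) = i"
      using spoils_unique by blast
    with \<Omega> show "i \<in> (\<lambda>\<Omega>. THE i. spoils N \<Omega> i) ` S"
      by (intro image_eqI[of _ _ \<Omega>]) auto
  qed
  show "finite {i. \<exists>\<Omega>\<in>S. spoils N \<Omega> i}" "card {i. \<exists>\<Omega>\<in>S. spoils N \<Omega> i} \<le> card S"
    using finite_surj[OF assms sub] surj_card_le[OF assms sub] by auto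
qed

text \<open>Union bound: \<open>2 ^ (N + 1)\<close> sets, each of size at most
  \<open>2 ^ w / 2 ^ (N + 3)\<close>, account for a quarter of \<open>2 ^ w\<close>.\<close>

lemma card_covered_le:
  fixes x :: "nat \<Rightarrow> nat"
  assumes "finite S" "card S \<le> 2 ^ (N + 1)" "inj x"
    and S: "\<And>\<Omega>. \<Omega> \<in> S \<Longrightarrow> finite \<Omega> \<and> card \<Omega> * 2 ^ (N + 3) \<le> 2 ^ w"
  shows "4 * card {v. \<exists>\<Omega>\<in>S. x v \<in> \<Omega>} \<le> 2 ^ w"
proof -
  have "{v. \<exists>\<Omega>\<in>S. x v \<in> \<Omega>} = (\<Union>\<Omega>\<in>S. x -` \<Omega>)"
    by auto
  then have "card {v. \<exists>\<Omega>\<in>S. x v \<in> \<Omega>} \<le> (\<Sum>\<Omega>\<in>S. card (x -` \<Omega>))"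
    using card_UN_le[OF assms(1)] by metis
  also have "\<dots> \<le> (\<Sum>\<Omega>\<in>S. card \<Omega>)"
    using S assms(3) by (intro sum_mono card_vimage_inj_on_le[where D = UNIV, simplified]) auto
  finally have "card {v. \<exists>\<Omega>\<in>S. x v \<in> \<Omega>} * 2 ^ (N + 3) \<le> (\<Sum>\<Omega>\<in>S. card \<Omega>) * 2 ^ (N + 3)"
    by (rule mult_right_mono) simp
  also have "\<dots> = (\<Sum>\<Omega>\<in>S. card \<Omega> * 2 ^ (N + 3))"
    by (rule sum_distrib_right)
  also have "\<dots> \<le> card S * 2 ^ w"
    using S by (intro sum_bounded_above[where 'a = nat, simplified]) auto
  also have "\<dots> \<le> 2 ^ (N + 1) * 2 ^ w"
    using assms(2) by (rule mult_right_mono) simp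
  finally show ?thesis
    by (simp add: power_add)
qed

text \<open>At least three quarters of the scales are unspoiled, and at each of these at least three
  quarters of the words are nonstochastic; \<open>9 / 16\<close> exceeds
  \<open>1 / 2\<close>.\<close>

lemma fraction_nonstochastic_ge:
  assumes C: "\<And>N i v y. v < 2 ^ width N i \<Longrightarrow>
      cond_complexity U (point N i v) y \<le> enat (prod_encode (N, i) + 1 + width N i + C)"
    and "C \<le> N" "\<alpha> \<le> N" "\<beta> \<le> 2 ^ (2 ^ N)"
  shows "1 / 2 \<le> (\<Sum>i<scales N. real (card {v. v < 2 ^ width N i \<and>
      \<not> stochastic U \<alpha> \<beta> (point N i v)}) / (real (scales N) * 2 ^ width N i))"
proof -
  define S where "S = {\<Omega>. finite \<Omega> \<and> complexity U (set_code \<Omega>) \<le> enat N}"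
  have S: "finite S" "card S \<le> 2 ^ (N + 1)"
    unfolding S_def by (rule card_sets_of_complexity_le)+
  define B where "B = {i. \<exists>\<Omega>\<in>S. spoils N \<Omega> i}"
  have B: "finite B" "card B \<le> 2 ^ (N + 1)"
    using card_spoiled[OF S(1), of N] S(2) by (auto simp: B_def)
  let ?good = "\<lambda>i. {v. v < 2 ^ width N i \<and> \<not> stochastic U \<alpha> \<beta> (point N i v)}"
  let ?f = "\<lambda>i. real (card (?good i)) / (real (scales N) * 2 ^ width N i)"
  have good: "3 * 2 ^ width N i \<le> 4 * card (?good i)" if i: "i < scales N" "i \<notin> B" for i
  proof -
    define S' where "S' = {\<Omega>\<in>S. card \<Omega> * 2 ^ (N + 3) \<le> 2 ^ width N i}"
    let ?bad = "{v. \<exists>\<Omega>\<in>S'. point N i v \<in> \<Omega>}"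
    have "card S' \<le> card S"
      unfolding S'_def using S(1) by (intro card_mono) auto
    then have S': "finite S'" "card S' \<le> 2 ^ (N + 1)"
      using S by (auto simp: S'_def)
    have bad: "4 * card ?bad \<le> 2 ^ width N i"
      by (rule card_covered_le[OF S']) (auto simp: S'_def S_def inj_def)
    have "?bad = (\<Union>\<Omega>\<in>S'. point N i -` \<Omega>)"
      by auto
    also have "finite \<dots>"
      using S'(1) by (intro finite_UN_I finite_vimageI) (auto simp: S'_def S_def inj_def)
    finally have finbad: "finite ?bad" .
    \<comment> \<open>A stochastic word at an unspoiled scale has a model neither above the window
      nor inside it, hence a small one.\<close>
    have "{..<2 ^ width N i} \<subseteq> ?good i \<union> ?bad"
    proof
      fix v
      assume "v \<in> {..<(2::nat) ^ width N i}"
      then have v: "v < 2 ^ width N i"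
        by simp
      show "v \<in> ?good i \<union> ?bad"
      proof (cases "stochastic U \<alpha> \<beta> (point N i v)")
        case True
        then obtain \<Omega> where \<Omega>: "finite \<Omega>" "point N i v \<in> \<Omega>"
            "complexity U (set_code \<Omega>) \<le> enat \<alpha>"
            "ereal (log 2 (real (card \<Omega>)) - real \<beta>)
              \<le> ereal_of_enat (cond_complexity U (point N i v) (set_code \<Omega>))"
          unfolding stochastic_def by blast
        have "\<Omega> \<in> S"
          using \<Omega>(1,3) \<open>\<alpha> \<le> N\<close> by (auto simp: S_def intro: order_trans)
        moreover have "card \<Omega> * 2 ^ (N + 3) \<le> 2 ^ (width N i + gap N)"
          using \<Omega> i(1) assms(2,4) by (intro model_of_point_small[OF C[OF v]])
        ultimately have "\<Omega> \<in> S'"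
          using i(2) by (auto simp: S'_def B_def spoils_def not_less)
        with \<Omega>(2) show ?thesis
          by auto
      qed (use v in auto)
    qed
    then have "card {..<(2::nat) ^ width N i} \<le> card (?good i \<union> ?bad)"
      using finbad by (intro card_mono) auto
    also have "\<dots> \<le> card (?good i) + card ?bad"
      by (rule card_Un_le)
    finally show ?thesis
      using bad by simp
  qed
  have "scales N - card B \<le> card ({..<scales N} - B)"
    using diff_card_le_card_Diff[OF B(1), of "{..<scales N}"] by simp
  \<comment> \<open>The exponent \<open>N + 3\<close> in \<open>scales\<close> makes their number
    four times the bound on \<open>card B\<close>.\<close>
  moreover have "4 * card B \<le> scales N"
    using B(2) by (simp add: scales_def power_add)
  ultimately have "3 * scales N \<le> 4 * card ({..<scales N} - B)"
    by simp
  then have "3 * real (scales N) \<le> 4 * real (card ({..<scales N} - B))"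
    by linarith
  moreover have pos: "real (scales N) > 0"
    by (simp add: scales_def)
  ultimately have "1 / 2 \<le> real (card ({..<scales N} - B)) * (3 / (4 * real (scales N)))"
    by (simp add: field_simps)
  also have "\<dots> = (\<Sum>i\<in>{..<scales N} - B. 3 / (4 * real (scales N)))"
    by simp
  also have "\<dots> \<le> (\<Sum>i\<in>{..<scales N} - B. ?f i)"
  proof (rule sum_mono)
    fix i
    assume "i \<in> {..<scales N} - B"
    then have "3 * 2 ^ width N i \<le> 4 * card (?good i)"
      using good by simp
    then have "real (3 * 2 ^ width N i) \<le> real (4 * card (?good i))"
      by (simp only: of_nat_le_iff)
    with pos show "3 / (4 * real (scales N)) \<le> ?f i"
      by (simp add: field_simps)
  qed
  also have "\<dots> \<le> (\<Sum>i<scales N. ?f i)"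
    by (intro sum_mono2) auto
  finally show ?thesis .
qed

section \<open>The spread semimeasure\<close>

text \<open>
  Only \<open>N \<ge> C\<close> is used, so that the additive constant \<open>C\<close> of the optimal machine is covered by
  the term \<open>2 * N\<close> of \<open>gap N\<close>.
\<close>

definition spread :: "(nat \<Rightarrow> real) \<Rightarrow> nat \<Rightarrow> nat \<Rightarrow> real" where
  "spread m C x =
     (let z = x - 1; N = pfst (pfst z); i = psnd (pfst z); v = psnd z
      in m (N - C + 1) *
        (real (if C \<le> N then if Suc i \<le> scales N then if Suc v \<le> 2 ^ width N i
                then 1 else 0 else 0 else 0) /
         real (scales N * 2 ^ width N i)))"

definition block :: "nat \<Rightarrow> nat set" where
  "block N = (\<lambda>(i, v). point N i v) ` (SIGMA i:{..<scales N}. {..<2 ^ width N i})"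

lemma spread_point:
  assumes "C \<le> N" "i < scales N" "v < 2 ^ width N i"
  shows "spread m C (point N i v) = m (N - C + 1) / (real (scales N) * 2 ^ width N i)"
  using assms by (simp add: spread_def point_def Suc_le_eq)

lemma spread_nonzero:
  assumes "spread m C x \<noteq> 0" "x \<ge> 1"
  obtains N where "C \<le> N" "x \<in> block N"
proof -
  define z where "z = x - 1"
  define N i v where "N = pfst (pfst z)" and "i = psnd (pfst z)" and "v = psnd z"
  have "x = point N i v"
    using assms(2) by (simp add: N_def i_def v_def point_def z_def)
  moreover have "C \<le> N" "i < scales N" "v < 2 ^ width N i"
    using assms(1)
    by (auto simp: spread_def Let_def N_def i_def v_def z_def Suc_le_eq split: if_splits)
  ultimately show ?thesis
    by (intro that[of N]) (auto simp: block_def)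
qed

lemma finite_block [simp]: "finite (block N)"
  by (simp add: block_def)

lemma disjoint_blocks: "N \<noteq> N' \<Longrightarrow> block N \<inter> block N' = {}"
  by (auto simp: block_def)

lemma block_subset: "block N \<subseteq> {1..}"
  by (auto simp: block_def)

text \<open>Used twice: with \<open>P\<close> always true for the full weight of a block, and with
  nonstochasticity for the lower bound.\<close>

lemma sum_spread_block:
  assumes "C \<le> N"
  shows "sum (spread m C) {x\<in>block N. P x} = m (N - C + 1) *
    (\<Sum>i<scales N. real (card {v. v < 2 ^ width N i \<and> P (point N i v)}) /
      (real (scales N) * 2 ^ width N i))"
proof -
  let ?V = "\<lambda>i. {v. v < 2 ^ width N i \<and> P (point N i v)}"
  have "{x\<in>block N. P x} = (\<lambda>(i, v). point N i v) ` (SIGMA i:{..<scales N}. ?V i)"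
    by (auto simp: block_def)
  then have "sum (spread m C) {x\<in>block N. P x} =
      (\<Sum>(i, v)\<in>(SIGMA i:{..<scales N}. ?V i). spread m C (point N i v))"
    by (simp add: sum.reindex inj_on_def case_prod_beta')
  also have "\<dots> = (\<Sum>i<scales N. \<Sum>v\<in>?V i. spread m C (point N i v))"
    by (subst sum.Sigma) auto
  also have "\<dots> = (\<Sum>i<scales N. \<Sum>v\<in>?V i. m (N - C + 1) / (real (scales N) * 2 ^ width N i))"
    using assms by (intro sum.cong refl spread_point) auto
  also have "\<dots> = m (N - C + 1) *
      (\<Sum>i<scales N. real (card (?V i)) / (real (scales N) * 2 ^ width N i))"
    by (simp add: sum_distrib_left mult.commute)
  finally show ?thesis .
qed

lemma sum_spread_full_block:
  assumes "C \<le> N"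
  shows "sum (spread m C) (block N) = m (N - C + 1)"
proof -
  have "real (card {v::nat. v < 2 ^ w}) = 2 ^ w" for w
    using card_Collect_less_nat[of "2 ^ w"] by simp
  moreover have "scales N > 0"
    by (simp add: scales_def)
  ultimately show ?thesis
    using sum_spread_block[OF assms, of m "\<lambda>_. True"] by simp
qed

lemma spread_nonneg:
  assumes "universal_semimeasure m"
  shows "0 \<le> spread m C x"
  using universal_semimeasureD(1)[OF assms] by (simp add: spread_def Let_def)

text \<open>The nested conditionals form a computable 0/1 weight, so
  \<open>lower_semicomputable_reweight\<close> applies.\<close>

lemma lower_semicomputable_spread:
  assumes "universal_semimeasure m"
  shows "lower_semicomputable (spread m C)"
  unfolding spread_def Let_def
  by (intro lower_semicomputable_reweight universal_semimeasureD(4)[OF assms]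
      total_recursive_intros total_recursive_scales total_recursive_width)
    (auto simp: scales_def)

text \<open>Each block with \<open>C \<le> N\<close> carries one value of \<open>m\<close>, taken at
  a different argument for each block, so the total is bounded by that of \<open>m\<close>.\<close>

lemma semimeasure_spread:
  assumes m: "universal_semimeasure m"
  shows "semimeasure (spread m C)"
proof (rule semimeasure_finite_sums)
  show "0 \<le> spread m C x" for x
    by (rule spread_nonneg[OF m])
  fix F :: "nat set"
  assume F: "finite F" "F \<subseteq> {1..}"
  define N where "N x = (SOME N. C \<le> N \<and> x \<in> block N)" for x
  have N: "C \<le> N x \<and> x \<in> block (N x)" if x: "x \<in> F" "spread m C x \<noteq> 0" for x
  proof -
    have "x \<ge> 1"
      using x(1) F(2) by auto
    with x(2) obtain n where "C \<le> n" "x \<in> block n"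
      by (rule spread_nonzero)
    then have "C \<le> n \<and> x \<in> block n" ..
    then show ?thesis
      unfolding N_def by (rule someI)
  qed
  define I where "I = N ` {x\<in>F. spread m C x \<noteq> 0}"
  have I: "finite I" "\<And>n. n \<in> I \<Longrightarrow> C \<le> n"
    using F(1) N by (auto simp: I_def)
  \<comment> \<open>\<open>C \<le> n\<close> on \<open>I\<close> keeps the truncated subtraction
    injective.\<close>
  have inj: "inj_on (\<lambda>n. n - C + 1) I"
  proof (rule inj_onI)
    fix a b
    assume "a \<in> I" "b \<in> I" "a - C + 1 = b - C + 1"
    with I(2)[of a] I(2)[of b] show "a = b"
      by linarith
  qed
  have "sum (spread m C) F = sum (spread m C) {x\<in>F. spread m C x \<noteq> 0}"
    using F(1) by (intro sum.mono_neutral_right) auto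
  also have "\<dots> \<le> sum (spread m C) (\<Union>n\<in>I. block n)"
  proof (rule sum_mono2)
    show "finite (\<Union>n\<in>I. block n)"
      by (intro finite_UN_I I(1) finite_block)
    show "{x\<in>F. spread m C x \<noteq> 0} \<subseteq> (\<Union>n\<in>I. block n)"
    proof
      fix x
      assume "x \<in> {x\<in>F. spread m C x \<noteq> 0}"
      then have "x \<in> block (N x)" "N x \<in> I"
        using N by (auto simp: I_def)
      then show "x \<in> (\<Union>n\<in>I. block n)"
        by (intro UN_I)
    qed
  qed (rule spread_nonneg[OF m])
  also have "\<dots> = (\<Sum>n\<in>I. sum (spread m C) (block n))"
    using disjoint_blocks by (intro sum.UNION_disjoint I(1) ballI impI finite_block)
  also have "\<dots> = (\<Sum>n\<in>I. m (n - C + 1))"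
    by (intro sum.cong refl sum_spread_full_block I(2))
  also have "\<dots> = sum m ((\<lambda>n. n - C + 1) ` I)"
    by (simp only: sum.reindex[OF inj] comp_def)
  also have "\<dots> \<le> mass m {1..}"
    using I(1) by (intro sum_universal_semimeasure_le_mass[OF m]) auto
  also have "\<dots> \<le> 1"
    using universal_semimeasureD(3)[OF m] by (simp add: mass_def)
  finally show "sum (spread m C) F \<le> 1" .
qed

text \<open>Every \<open>n > \<alpha>\<close> places at least half of \<open>m n\<close> on
  nonstochastic points of its own block; domination of \<open>spread\<close> turns this into mass of
  \<open>m\<close>.\<close>

lemma mass_nonstochastic_ge:
  assumes m: "universal_semimeasure m" and U: "optimal_prefix_free_machine U"
  obtains c where "c > 0"
    "\<And>\<alpha> \<beta>. \<beta> \<le> 2 ^ (2 ^ \<alpha>) \<Longrightarrow> tau m \<alpha> \<le> c * mass m (nonstochastic_set U \<alpha> \<beta>)"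
proof -
  obtain C where C: "\<And>N i v y. v < 2 ^ width N i \<Longrightarrow>
      cond_complexity U (point N i v) y \<le> enat (prod_encode (N, i) + 1 + width N i + C)"
    using complexity_point_le[OF U] by metis
  obtain c where c: "c > 0" "\<And>x. x \<ge> 1 \<Longrightarrow> spread m C x \<le> c * m x"
    using universal_semimeasure_dominates[OF m semimeasure_spread[OF m]
        lower_semicomputable_spread[OF m]] by metis
  show ?thesis
  proof (rule that)
    show "2 * c > 0"
      using c(1) by simp
    fix \<alpha> \<beta> :: nat
    assume \<beta>: "\<beta> \<le> 2 ^ (2 ^ \<alpha>)"
    let ?P = "\<lambda>x. \<not> stochastic U \<alpha> \<beta> x"
    show "tau m \<alpha> \<le> 2 * c * mass m (nonstochastic_set U \<alpha> \<beta>)"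
      unfolding tau_def
    proof (rule mass_leI[OF m])
      fix F
      assume F: "finite F" "F \<subseteq> {\<alpha> + 1..}"
      have half: "m n / 2 \<le> sum (spread m C) {x\<in>block (n - 1 + C). ?P x}" if "n \<in> F" for n
      proof -
        \<comment> \<open>This inverts the index \<open>N - C + 1\<close> of \<open>spread\<close>.
          From \<open>n > \<alpha>\<close> follows \<open>N \<ge> \<alpha>\<close>, so the bound on
          \<open>\<beta>\<close> carries over to \<open>N\<close>.\<close>
        define N where "N = n - 1 + C"
        have n: "\<alpha> \<le> N" "C \<le> N" "N - C + 1 = n"
          using that F(2) by (auto simp: N_def)
        have "(2::nat) ^ 2 ^ \<alpha> \<le> 2 ^ 2 ^ N"
          using n(1) by (intro power_increasing) auto
        with \<beta> have "\<beta> \<le> 2 ^ 2 ^ N"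
          by (rule order_trans)
        from fraction_nonstochastic_ge[OF C n(2,1) this]
        have "m n * (1 / 2) \<le> m n * (\<Sum>i<scales N. real (card {v. v < 2 ^ width N i \<and>
            ?P (point N i v)}) / (real (scales N) * 2 ^ width N i))"
          using universal_semimeasureD(1)[OF m] that F(2) by (intro mult_left_mono) auto
        then show ?thesis
          using sum_spread_block[OF n(2), of m ?P] n(3) by (simp add: N_def)
      qed
      let ?A = "\<Union>n\<in>F. {x\<in>block (n - 1 + C). ?P x}"
      have A: "finite ?A" "?A \<subseteq> nonstochastic_set U \<alpha> \<beta>" "?A \<subseteq> {1..}"
        using F(1) block_subset by (auto simp: nonstochastic_set_def)
      have "sum m F / 2 = (\<Sum>n\<in>F. m n / 2)"
        by (rule sum_divide_distrib)
      also have "\<dots> \<le> (\<Sum>n\<in>F. sum (spread m C) {x\<in>block (n - 1 + C). ?P x})"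
        by (intro sum_mono half)
      also have "\<dots> = sum (spread m C) ?A"
      proof (rule sum.UNION_disjoint[symmetric])
        show "\<forall>i\<in>F. \<forall>j\<in>F. i \<noteq> j \<longrightarrow>
            {x\<in>block (i - 1 + C). ?P x} \<inter> {x\<in>block (j - 1 + C). ?P x} = {}"
        proof (intro ballI impI)
          fix i j
          assume "i \<in> F" "j \<in> F" "i \<noteq> j"
          \<comment> \<open>Elements of \<open>F\<close> are at least 1, so the truncated
            subtraction does not identify any two of them.\<close>
          then have "i - 1 + C \<noteq> j - 1 + C"
            using F(2) by (metis Suc_diff_1 Suc_eq_plus1 add_right_cancel atLeast_iff
                add_is_0 bot_nat_0.extremum_uniqueI not_gr_zero one_neq_zero subsetD)
          from disjoint_blocks[OF this]
          show "{x\<in>block (i - 1 + C). ?P x} \<inter> {x\<in>block (j - 1 + C). ?P x} = {}"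
            by blast
        qed
      qed (use F(1) in auto)
      also have "\<dots> \<le> (\<Sum>x\<in>?A. c * m x)"
        using A(3) by (intro sum_mono c(2)) auto
      also have "\<dots> = c * sum m ?A"
        by (rule sum_distrib_left[symmetric])
      also have "\<dots> \<le> c * mass m (nonstochastic_set U \<alpha> \<beta>)"
        using A(1,2) c(1) by (intro mult_left_mono sum_universal_semimeasure_le_mass[OF m])
          (auto simp: nonstochastic_set_def)
      finally show "sum m F \<le> 2 * c * mass m (nonstochastic_set U \<alpha> \<beta>)"
        by simp
    qed auto
  qed
qed

theorem theorem1:
  fixes m :: "nat \<Rightarrow> real" and U :: machine
  assumes "universal_semimeasure m"
    and "optimal_prefix_free_machine U"
  shows "\<exists>c::real. c > 1 \<and>
    (\<forall>\<alpha> \<beta> :: nat. \<beta> \<le> 2 ^ (2 ^ \<alpha>) \<longrightarrow>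
       tau m \<alpha> / c \<le> mass m (nonstochastic_set U \<alpha> \<beta>) \<and>
       mass m (nonstochastic_set U \<alpha> \<beta>) \<le> c * tau m \<alpha>)"
proof -
  obtain a where a: "a > 0" "\<And>\<alpha> \<beta>. mass m (nonstochastic_set U \<alpha> \<beta>) \<le> a * tau m \<alpha>"
    using mass_nonstochastic_le[OF assms] by metis
  obtain b where b: "b > 0"
    "\<And>\<alpha> \<beta>. \<beta> \<le> 2 ^ (2 ^ \<alpha>) \<Longrightarrow> tau m \<alpha> \<le> b * mass m (nonstochastic_set U \<alpha> \<beta>)"
    using mass_nonstochastic_ge[OF assms] by metis
  have nonneg: "0 \<le> mass m A" if "A \<subseteq> {1..}" for A
    using sum_universal_semimeasure_le_mass[OF assms(1), of "{}" A] that by simp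
  \<comment> \<open>The sum dominates both constants, and the added 1 gives
    \<open>?c > 1\<close>.\<close>
  let ?c = "a + b + 1"
  show ?thesis
  proof (intro exI[of _ ?c] conjI allI impI)
    show "?c > 1"
      using a(1) b(1) by simp
    fix \<alpha> \<beta> :: nat
    assume \<beta>: "\<beta> \<le> 2 ^ (2 ^ \<alpha>)"
    have "0 \<le> mass m (nonstochastic_set U \<alpha> \<beta>)"
      by (rule nonneg) (auto simp: nonstochastic_set_def)
    then have "b * mass m (nonstochastic_set U \<alpha> \<beta>) \<le> ?c * mass m (nonstochastic_set U \<alpha> \<beta>)"
      using a(1) by (intro mult_right_mono) auto
    then have "tau m \<alpha> \<le> ?c * mass m (nonstochastic_set U \<alpha> \<beta>)"
      using b(2)[OF \<beta>] by linarith
    then show "tau m \<alpha> / ?c \<le> mass m (nonstochastic_set U \<alpha> \<beta>)"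
      using a(1) b(1) by (simp add: divide_le_eq mult.commute)
    have "0 \<le> tau m \<alpha>"
      unfolding tau_def by (rule nonneg) auto
    then have "a * tau m \<alpha> \<le> ?c * tau m \<alpha>"
      using b(1) by (intro mult_right_mono) auto
    then show "mass m (nonstochastic_set U \<alpha> \<beta>) \<le> ?c * tau m \<alpha>"
      using a(2)[of \<alpha> \<beta>] by linarith
  qed
qed

end
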